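(* Let $q$ be a complex number with $|q|<1$. Then the following four identities hold: \begin{align*} &\sum_{n,m\geq 0}\frac{(-1)^{\binom{n-m}{2}}q^{\frac{3m^2}{4}+\frac{mn}{2}+\frac{3n^2}{4}}}{(q;q)_m(q;q)_n}=\frac{1}{\bigl(q^2,q^8;q^{10}\bigr)_{\infty}},\\ &\sum_{n,m\geq 0}\frac{(-1)^{\binom{n-m}{2}}q^{\frac{3m^2}{4}+\frac{mn}{2}+\frac{3n^2}{4}+m+n}}{(q;q)_m(q;q)_n}=\frac{1}{\bigl(q^4,q^6;q^{10}\bigr)_{\infty}},\\ &\sum_{n,m\geq 0}\frac{(-1)^mq^{\frac{m^2}{4}+\frac{mn}{2}+\frac{n^2}{4}}}{\bigl(q^2;q^2\bigr)_m\bigl(q^2;q^2\bigr)_n} =\frac{1}{\bigl(-q^2;q^2\bigr)_{\infty}\bigl(q,q^4;q^5\bigr)_{\infty}},\\ &\sum_{n,m\geq 0}\frac{(-1)^mq^{\frac{m^2}{4}+\frac{mn}{2}+\frac{n^2}{4}+m+n}}{\bigl(q^2;q^2\bigr)_m\bigl(q^2;q^2\bigr)_n} =\frac{1}{\bigl(-q^2;q^2\bigr)_{\infty}\bigl(q^2,q^3;q^5\bigr)_{\infty}}, \end{align*} where the sums run over all pairs of nonnegative integers $(n,m)$.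
   Context: Standard $q$-Pochhammer notation: $(a;q)_0=1$, $(a;q)_n=\prod_{k=0}^{n-1}(1-aq^k)$ for $n\ge1$, $(a;q)_\infty=\prod_{k=0}^{\infty}(1-aq^k)$, and $(a_1,\dots,a_m;q)_n=(a_1;q)_n\cdots(a_m;q)_n$ for $n\in\mathbb{N}\cup\{\infty\}$. For an integer $k$ (possibly negative), $\binom{k}{2}=k(k-1)/2$. Fractional powers of $q$ are taken with respect to a fixed choice of $q^{1/4}$ (with $q^{a/4}=(q^{1/4})^a$ for integers $a$); equivalently the identities may be read as identities of formal power series in $q^{1/4}$. *)

theory Defs
  imports "HOL-Analysis.Analysis"
begin

definition qpoch :: "complex \<Rightarrow> complex \<Rightarrow> nat \<Rightarrow> complex" where
  "qpoch a q n = (\<Prod>k<n. 1 - a * q ^ k)"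

definition qpoch_inf :: "complex \<Rightarrow> complex \<Rightarrow> complex" where
  "qpoch_inf a q = (\<Prod>k. 1 - a * q ^ k)"

definition qpochs_inf :: "complex list \<Rightarrow> complex \<Rightarrow> complex" where
  "qpochs_inf as q = (\<Prod>a\<leftarrow>as. qpoch_inf a q)"

text \<open>The binomial coefficient ``\<open>k\<close> choose 2'' for a possibly negative integer \<open>k\<close>;
  the division is exact and the value is never negative.\<close>

definition int_choose_two :: "int \<Rightarrow> int" where
  "int_choose_two k = k * (k - 1) div 2"

end

theory Submission
  imports Defs
begin

text \<open>
  Group each double series by \<open>N = n + m\<close>. In the first two the inner sum vanishes for odd \<open>N\<close>
  by the symmetry \<open>n \<leftrightarrow> m\<close>, and for \<open>N = 2 K\<close> it is Gauss' alternating sum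
  \<open>\<Sum>\<^sub>j (-1)\<^sup>j q\<^bsub>j\<^sup>2\<^esub> / ((q;q)\<^bsub>K-j\<^esub> (q;q)\<^bsub>K+j\<^esub>) = 1 / (q\<^sup>2;q\<^sup>2)\<^sub>K\<close>; what remains are the
  Rogers--Ramanujan identities in base \<open>q\<^sup>2\<close>. In the last two the inner sum is the Rogers--Szego
  polynomial of base \<open>q\<^sup>2\<close> at \<open>-1\<close>, which vanishes for odd \<open>N\<close> and is \<open>1 / (q\<^sup>4;q\<^sup>4)\<^sub>k\<close> for
  \<open>N = 2 k\<close>. Multiplying by \<open>(-q\<^sup>2;q\<^sup>2)\<^sub>\<infinity>\<close> and expanding \<open>(-q\<^bsub>2k+2\<^esub>;q\<^sup>2)\<^sub>\<infinity>\<close> by Euler's theorem gives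
  a double series whose antidiagonal sums are Rogers--Szego polynomials again, now at \<open>q\<close>, and so
  the terms of the Rogers--Ramanujan series in base \<open>q\<close>.

  The Rogers--Ramanujan identities follow by applying Bailey's lemma twice to the unit Bailey pair
  (relative to \<open>a = q\<^sup>e\<close>, \<open>e \<in> {0, 1}\<close>), letting \<open>N \<rightarrow> \<infinity>\<close>, and using the Jacobi triple product. The
  finite identities all follow from two recurrences for sums of the form
  \<open>\<Sum>\<^sub>j a\<^sub>j / ((q;q)\<^bsub>M-j\<^esub> (q;q)\<^bsub>N+j\<^esub>)\<close>.
\<close>

section \<open>Dominated convergence and sums over the integers\<close>

lemma tendsto_infsum_dominated:
  fixes f :: "'b \<Rightarrow> 'a \<Rightarrow> 'c::banach"
  assumes bound: "\<And>n x. x \<in> A \<Longrightarrow> norm (f n x) \<le> M x" and M: "M summable_on A"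
    and lim: "\<And>x. x \<in> A \<Longrightarrow> ((\<lambda>n. f n x) \<longlongrightarrow> g x) F" and F: "F \<noteq> bot"
  shows "((\<lambda>n. infsum (f n) A) \<longlongrightarrow> infsum g A) F"
proof (rule swap_uniform_limit'[where f = "\<lambda>X n. \<Sum>x\<in>X. f n x" and g = "\<lambda>X. sum g X"
        and F = "finite_subsets_at_top A" and S = UNIV])
  have f: "f n summable_on A" for n
    by (rule abs_summable_summable[OF Infinite_Sum.abs_summable_on_comparison_test'[OF M bound]])
  have "norm (g x) \<le> M x" if "x \<in> A" for x
    using tendsto_upperbound[OF tendsto_norm[OF lim[OF that]] always_eventually F] bound[OF that]
    by blast
  then have "g summable_on A"
    by (rule abs_summable_summable[OF Infinite_Sum.abs_summable_on_comparison_test'[OF M]])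
  then show "(sum g \<longlongrightarrow> infsum g A) (finite_subsets_at_top A)"
    by (rule infsum_tendsto)
  show "\<forall>\<^sub>F X in finite_subsets_at_top A. ((\<lambda>n. \<Sum>x\<in>X. f n x) \<longlongrightarrow> sum g X) F"
    using lim by (auto intro!: eventually_finite_subsets_at_top_weakI tendsto_sum)
  show "uniform_limit UNIV (\<lambda>X n. \<Sum>x\<in>X. f n x) (\<lambda>n. infsum (f n) A) (finite_subsets_at_top A)"
    by (rule Weierstrass_m_test_general'[where M = M])
       (use bound f M in \<open>auto intro: has_sum_infsum\<close>)
qed (auto simp: F)

lemma infsum_int_shift: "(\<Sum>\<^sub>\<infinity>j. f (j + k)) = (\<Sum>\<^sub>\<infinity>j::int. f j)"
  by (rule infsum_reindex_bij_witness[of _ "\<lambda>j. j - k" "\<lambda>j. j + k"]) auto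

lemma infsum_int_reflect: "(\<Sum>\<^sub>\<infinity>j. f (- j)) = (\<Sum>\<^sub>\<infinity>j::int. f j)"
  by (rule infsum_reindex_bij_witness[of _ "\<lambda>j. - j" "\<lambda>j. - j"]) auto

lemma summable_on_int:
  fixes f :: "int \<Rightarrow> 'a::{uniform_topological_group_add, topological_comm_monoid_add, ab_group_add,
    complete_uniform_space}"
  assumes "(\<lambda>n. f (int n)) summable_on UNIV" "(\<lambda>n. f (- int n)) summable_on UNIV"
  shows "f summable_on UNIV"
proof -
  have "f summable_on range int"
    using assms(1) by (subst summable_on_reindex) (auto simp: o_def)
  moreover have "f summable_on range (\<lambda>n. - int n)"
    using assms(2) by (subst summable_on_reindex) (auto simp: o_def inj_def)
  ultimately have "f summable_on range int \<union> range (\<lambda>n. - int n)"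
    by (rule summable_on_union)
  moreover have "j \<in> range int \<union> range (\<lambda>n. - int n)" for j :: int
    by (cases j rule: int_cases2) auto
  then have "range int \<union> range (\<lambda>n. - int n) = UNIV" by blast
  ultimately show ?thesis by simp
qed

lemma has_sum_even_nat:
  assumes "\<And>n::nat. odd n \<Longrightarrow> g n = 0"
  shows "(g has_sum S) UNIV \<longleftrightarrow> ((\<lambda>k. g (2 * k)) has_sum S) UNIV"
proof -
  have "(g has_sum S) UNIV \<longleftrightarrow> (g has_sum S) (range ((*) 2))"
    using assms by (intro has_sum_cong_neutral) (auto simp: image_iff elim: evenE)
  also have "\<dots> \<longleftrightarrow> ((\<lambda>k. g (2 * k)) has_sum S) UNIV"
    by (subst has_sum_reindex) (auto simp: o_def inj_def)
  finally show ?thesis .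
qed

lemma has_sum_antidiagonals:
  fixes f :: "nat \<times> nat \<Rightarrow> 'a::{topological_comm_monoid_add, t3_space}"
  assumes "f summable_on UNIV"
  shows "(f has_sum S) UNIV \<longleftrightarrow> ((\<lambda>N. \<Sum>m\<le>N. f (N - m, m)) has_sum S) UNIV"
proof -
  let ?h = "\<lambda>x. f (fst x - snd x, snd x)"
  have reindex: "(f has_sum T) UNIV \<longleftrightarrow> (?h has_sum T) (SIGMA N:UNIV. {..N})" for T
    by (rule has_sum_reindex_bij_witness[of _ "\<lambda>x. (fst x - snd x, snd x)"
          "\<lambda>x. (fst x + snd x, snd x)"]) auto
  have antidiagonal: "((\<lambda>m. ?h (N, m)) has_sum (\<Sum>m\<le>N. f (N - m, m))) {..N}" for N
    by (rule has_sum_finiteI) simp_all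
  have "?h summable_on (SIGMA N:UNIV. {..N})"
    using assms reindex by (auto simp: summable_on_def)
  then show ?thesis
    unfolding reindex
    using has_sum_SigmaD[OF _ antidiagonal] has_sum_SigmaI[OF antidiagonal] by blast
qed

section \<open>The q-Pochhammer symbol\<close>

lemma qpoch_0 [simp]: "qpoch a q 0 = 1"
  by (simp add: qpoch_def)

lemma qpoch_Suc: "qpoch a q (Suc n) = qpoch a q n * (1 - a * q ^ n)"
  by (simp add: qpoch_def)

lemma qpoch_add: "qpoch a q (m + n) = qpoch a q m * qpoch (a * q ^ m) q n"
  by (induction n) (simp_all add: qpoch_Suc power_add mult_ac)

lemma qpoch_mult_uminus: "qpoch a q n * qpoch (- a) q n = qpoch (a\<^sup>2) (q\<^sup>2) n"
  by (induction n) (simp_all add: qpoch_Suc algebra_simps power2_eq_square power_mult_distrib)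

lemma qpoch_multisection: "qpoch a q (k * n) = (\<Prod>i<k. qpoch (a * q ^ i) (q ^ k) n)"
proof (induction n)
  case (Suc n)
  have "qpoch a q (k * Suc n) = qpoch a q (k * n) * qpoch (a * q ^ (k * n)) q k"
    using qpoch_add[of a q "k * n" k] by (simp add: add.commute)
  also have "qpoch (a * q ^ (k * n)) q k = (\<Prod>i<k. 1 - a * q ^ i * (q ^ k) ^ n)"
    unfolding qpoch_def by (simp add: power_mult mult_ac)
  finally show ?case
    by (simp add: Suc qpoch_Suc prod.distrib)
qed simp

lemma qpoch_nonzero:
  assumes "norm q < 1" "norm a < 1"
  shows "qpoch a q n \<noteq> 0"
proof -
  have "a * q ^ k \<noteq> 1" for k
  proof -
    have "norm (a * q ^ k) \<le> norm a * 1"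
      unfolding norm_mult norm_power using assms by (intro mult_left_mono power_le_one) auto
    then show ?thesis using assms(2) by auto
  qed
  then show ?thesis by (auto simp: qpoch_def)
qed

lemma convergent_prod_qpoch:
  fixes a q :: complex
  assumes "norm q < 1"
  shows "convergent_prod (\<lambda>k. 1 - a * q ^ k)"
proof -
  have "summable (\<lambda>k. norm ((1 - a * q ^ k) - 1))"
    using assms by (simp add: norm_mult norm_power summable_mult)
  then show ?thesis
    by (intro abs_convergent_prod_imp_convergent_prod summable_imp_abs_convergent_prod)
qed

lemma qpoch_tendsto:
  assumes "norm q < 1"
  shows "qpoch a q \<longlonglongrightarrow> qpoch_inf a q"
  using convergent_prod_LIMSEQ[OF convergent_prod_qpoch[OF assms, of a]]
  unfolding qpoch_def[abs_def] qpoch_inf_def LIMSEQ_lessThan_iff_atMost .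

lemma qpoch_inf_0 [simp]: "qpoch_inf 0 q = 1"
  by (simp add: qpoch_inf_def)

lemma qpoch_inf_nonzero:
  assumes "norm q < 1" "norm a < 1"
  shows "qpoch_inf a q \<noteq> 0"
  unfolding qpoch_inf_def
proof (rule prodinf_nonzero[OF convergent_prod_qpoch[OF assms(1)]])
  show "1 - a * q ^ k \<noteq> 0" for k
    using qpoch_nonzero[OF assms, of "Suc k"] by (simp add: qpoch_Suc)
qed

lemma qpoch_inf_split:
  assumes "norm q < 1"
  shows "qpoch_inf a q = qpoch a q n * qpoch_inf (a * q ^ n) q"
proof (rule LIMSEQ_unique)
  show "(\<lambda>m. qpoch a q (m + n)) \<longlonglongrightarrow> qpoch_inf a q"
    using qpoch_tendsto[OF assms] by (rule LIMSEQ_ignore_initial_segment)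
  show "(\<lambda>m. qpoch a q (m + n)) \<longlonglongrightarrow> qpoch a q n * qpoch_inf (a * q ^ n) q"
    unfolding add.commute[of _ n] qpoch_add by (intro tendsto_mult_left qpoch_tendsto assms)
qed

lemma qpoch_inf_multisection:
  assumes "norm q < 1" "k > 0"
  shows "qpoch_inf a q = (\<Prod>i<k. qpoch_inf (a * q ^ i) (q ^ k))"
proof (rule LIMSEQ_unique)
  show "(\<lambda>n. qpoch a q (k * n)) \<longlonglongrightarrow> qpoch_inf a q"
    using LIMSEQ_subseq_LIMSEQ[OF qpoch_tendsto[OF assms(1)], of "\<lambda>n. k * n"] assms(2)
    by (simp add: o_def strict_mono_def)
  have "norm (q ^ k) < 1"
    using assms by (simp add: norm_power power_less_one_iff)
  then show "(\<lambda>n. qpoch a q (k * n)) \<longlonglongrightarrow> (\<Prod>i<k. qpoch_inf (a * q ^ i) (q ^ k))"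
    unfolding qpoch_multisection by (intro tendsto_prod qpoch_tendsto)
qed

lemma powi_neq_one:
  fixes q :: "'a::real_normed_div_algebra"
  assumes "norm q < 1" "k > 0"
  shows "q powi k \<noteq> 1"
proof -
  have "norm (q ^ nat k) < 1"
    using assms by (simp add: norm_power power_less_one_iff)
  then show ?thesis using assms(2) by (auto simp: power_int_def)
qed

section \<open>Finite convolutions of inverse q-factorials\<close>

text \<open>Setting \<open>1 / (q;q)\<^sub>k = 0\<close> for \<open>k < 0\<close> makes \<open>1 / (q;q)\<^bsub>k-1\<^esub> = (1 - q\<^sup>k) / (q;q)\<^sub>k\<close> valid
  for all integers \<open>k\<close>, so that sums over \<open>j\<close> need no explicit range and can be shifted freely.\<close>

definition inv_qfact :: "complex \<Rightarrow> int \<Rightarrow> complex" where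
  "inv_qfact q k = (if k < 0 then 0 else 1 / qpoch q q (nat k))"

definition qconv :: "complex \<Rightarrow> (int \<Rightarrow> complex) \<Rightarrow> int \<Rightarrow> int \<Rightarrow> complex" where
  "qconv q a M N = (\<Sum>\<^sub>\<infinity>j. a j * inv_qfact q (M - j) * inv_qfact q (N + j))"

lemma inv_qfact_neg [simp]: "k < 0 \<Longrightarrow> inv_qfact q k = 0"
  and inv_qfact_0 [simp]: "inv_qfact q 0 = 1"
  and inv_qfact_of_nat: "inv_qfact q (int n) = 1 / qpoch q q n"
  by (simp_all add: inv_qfact_def)

lemma inv_qfact_diff_1:
  assumes "norm q < 1"
  shows "inv_qfact q (k - 1) = (1 - q powi k) * inv_qfact q k"
proof (cases "k > 0")
  case True
  then obtain n where n: "k = int (Suc n)" by (metis pos_int_cases Suc_pred)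
  then have "k - 1 = int n" by simp
  then show ?thesis
    using powi_neq_one[OF assms True] qpoch_nonzero[OF assms assms, of n]
    unfolding n by (simp only: inv_qfact_of_nat power_int_of_nat qpoch_Suc)
      (simp add: field_simps)
qed (cases "k = 0"; simp)

lemma inv_qfact_tendsto:
  assumes "norm q < 1"
  shows "(inv_qfact q \<longlongrightarrow> 1 / qpoch_inf q q) at_top"
proof -
  have "((\<lambda>k. 1 / qpoch q q (nat k)) \<longlongrightarrow> 1 / qpoch_inf q q) at_top"
    by (intro tendsto_divide tendsto_const qpoch_inf_nonzero assms
        filterlim_compose[OF qpoch_tendsto[OF assms] filterlim_nat_sequentially])
  moreover have "\<forall>\<^sub>F k in at_top. 1 / qpoch q q (nat k) = inv_qfact q k"
    using eventually_ge_at_top[of 0] by eventually_elim (simp add: inv_qfact_def)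
  ultimately show ?thesis by (rule Lim_transform_eventually)
qed

lemma inv_qfact_shift_tendsto:
  assumes "norm q < 1"
  shows "(\<lambda>n. inv_qfact q (int n + k)) \<longlonglongrightarrow> 1 / qpoch_inf q q"
proof (rule filterlim_compose[OF inv_qfact_tendsto[OF assms]])
  show "filterlim (\<lambda>n. int n + k) at_top sequentially"
    unfolding filterlim_at_top
  proof
    show "\<forall>\<^sub>F n in sequentially. Z \<le> int n + k" for Z
      using eventually_ge_at_top[of "nat (Z - k)"] by eventually_elim linarith
  qed
qed

lemma inv_qfact_bounded:
  assumes "norm q < 1"
  obtains C where "C > 0" "\<And>k. norm (inv_qfact q k) \<le> C"
proof -
  have "convergent (\<lambda>n. inv_qfact q (int n))"
    using inv_qfact_shift_tendsto[OF assms, of 0] by (auto simp: convergent_def)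
  then have "Bseq (\<lambda>n. inv_qfact q (int n))" by (rule convergent_imp_Bseq)
  then obtain C where C: "C > 0" "\<And>n. norm (inv_qfact q (int n)) \<le> C" by (auto elim: BseqE)
  have "norm (inv_qfact q k) \<le> C" for k
    using C(2)[of "nat k"] C(1) by (cases "k < 0") auto
  with C(1) that show thesis by blast
qed

lemma qconv_summable: "(\<lambda>j. a j * inv_qfact q (M - j) * inv_qfact q (N + j)) summable_on UNIV"
proof (rule finite_nonzero_values_imp_summable_on)
  have "{j \<in> UNIV. a j * inv_qfact q (M - j) * inv_qfact q (N + j) \<noteq> 0} \<subseteq> {- N..M}"
    by (auto simp: inv_qfact_def split: if_splits)
  then show "finite {j \<in> UNIV. a j * inv_qfact q (M - j) * inv_qfact q (N + j) \<noteq> 0}"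
    by (rule finite_subset) simp
qed

lemma qconv_shift: "qconv q a M N = qconv q (\<lambda>j. a (j + k)) (M - k) (N + k)"
  unfolding qconv_def
  by (subst infsum_int_shift[of _ k, symmetric]) (simp add: algebra_simps)

lemma qconv_reflect: "qconv q a M N = qconv q (\<lambda>j. a (- j)) N M"
  unfolding qconv_def
  by (subst infsum_int_reflect[symmetric]) (simp add: mult_ac)

lemma qconv_flip: "qconv q a N 0 = qconv q (\<lambda>j. a (N - j)) N 0"
  by (subst qconv_reflect, subst qconv_shift[of q _ _ _ "- N"]) simp

lemma qconv_cmult: "qconv q (\<lambda>j. c * a j) M N = c * qconv q a M N"
  unfolding qconv_def by (simp add: infsum_cmult_right' mult.assoc)

lemma qconv_eq_0: "M + N < 0 \<Longrightarrow> qconv q a M N = 0"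
  unfolding qconv_def by (rule infsum_0) (auto simp: inv_qfact_def)

lemma qconv_0_0: "qconv q a 0 0 = a 0"
proof -
  have "qconv q a 0 0 = (\<Sum>\<^sub>\<infinity>j\<in>{0}. a j * inv_qfact q (0 - j) * inv_qfact q (0 + j))"
    unfolding qconv_def by (rule infsum_cong_neutral) (auto simp: inv_qfact_def)
  then show ?thesis by simp
qed

lemma qconv_of_nat_0:
  "qconv q a (int N) 0 = (\<Sum>j\<le>N. a (int j) / (qpoch q q j * qpoch q q (N - j)))"
proof -
  have "qconv q a (int N) 0
      = (\<Sum>\<^sub>\<infinity>j\<in>int ` {..N}. a j * inv_qfact q (int N - j) * inv_qfact q j)"
    unfolding qconv_def
  proof (rule infsum_cong_neutral)
    fix j assume "j \<in> UNIV - int ` {..N}"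
    then have "j < 0 \<or> j > int N"
      by (metis Diff_iff atMost_iff image_eqI int_nat_eq linorder_not_less nat_le_iff)
    then show "a j * inv_qfact q (int N - j) * inv_qfact q (0 + j) = 0" by auto
  qed auto
  also have "\<dots> = (\<Sum>j\<le>N. a (int j) * inv_qfact q (int N - int j) * inv_qfact q (int j))"
    by (simp add: sum.reindex)
  also have "\<dots> = (\<Sum>j\<le>N. a (int j) / (qpoch q q j * qpoch q q (N - j)))"
    by (intro sum.cong) (auto simp: inv_qfact_of_nat simp flip: of_nat_diff)
  finally show ?thesis .
qed

lemma qconv_weight_left:
  assumes "norm q < 1"
  shows "qconv q (\<lambda>j. a j * q powi (M - j)) M N = qconv q a M N - qconv q a (M - 1) N"
proof -
  have "a j * inv_qfact q (M - j) * inv_qfact q (N + j)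
     = a j * inv_qfact q (M - 1 - j) * inv_qfact q (N + j)
       + a j * q powi (M - j) * inv_qfact q (M - j) * inv_qfact q (N + j)" for j
  proof -
    have "inv_qfact q (M - 1 - j) = (1 - q powi (M - j)) * inv_qfact q (M - j)"
      using inv_qfact_diff_1[OF assms, of "M - j"] by (simp add: algebra_simps)
    then show ?thesis by (simp only:) (simp add: algebra_simps)
  qed
  then have "qconv q a M N = qconv q a (M - 1) N + qconv q (\<lambda>j. a j * q powi (M - j)) M N"
    unfolding qconv_def infsum_add[OF qconv_summable qconv_summable, symmetric] by presburger
  then show ?thesis by simp
qed

locale nome =
  fixes q :: complex
  assumes q_nonzero: "q \<noteq> 0" and norm_q_less_1: "norm q < 1"
begin

lemma nome_power: "n > 0 \<Longrightarrow> nome (q ^ n)"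
  using q_nonzero norm_q_less_1 by unfold_locales (simp_all add: norm_power power_less_one_iff)

lemma norm_mult_q_less_1: "norm y \<le> 1 \<Longrightarrow> norm (y * q) < 1"
  using mult_mono[of "norm y" 1 "norm q" "norm q"] norm_q_less_1 by (simp add: norm_mult)

lemma qpoch_inf_q_nonzero: "qpoch_inf q q \<noteq> 0"
  by (intro qpoch_inf_nonzero norm_q_less_1)

lemma qconv_add_1_left:
  "(1 - q powi (M + N + 1)) * qconv q a (M + 1) N
    = qconv q a M N + qconv q (\<lambda>j. a (j + 1) * q powi (M - j)) M N"
proof -
  have termwise: "(1 - q powi (M + N + 1)) * (a j * inv_qfact q (M + 1 - j) * inv_qfact q (N + j))
     = a j * inv_qfact q (M - j) * inv_qfact q (N + j)
       + a j * q powi (M + 1 - j) * inv_qfact q (M + 1 - j) * inv_qfact q (N - 1 + j)" for j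
  proof -
    have weight: "1 - q powi (M + N + 1)
        = (1 - q powi (M + 1 - j)) + q powi (M + 1 - j) * (1 - q powi (N + j))"
      using q_nonzero by (simp add: algebra_simps flip: power_int_add)
    have "inv_qfact q (M - j) = (1 - q powi (M + 1 - j)) * inv_qfact q (M + 1 - j)"
      "inv_qfact q (N - 1 + j) = (1 - q powi (N + j)) * inv_qfact q (N + j)"
      using inv_qfact_diff_1[OF norm_q_less_1, of "M + 1 - j"]
        inv_qfact_diff_1[OF norm_q_less_1, of "N + j"] by (simp_all add: algebra_simps)
    then show ?thesis unfolding weight by (simp only:) (simp add: algebra_simps)
  qed
  have "(1 - q powi (M + N + 1)) * qconv q a (M + 1) N
      = qconv q a M N + qconv q (\<lambda>j. a j * q powi (M + 1 - j)) (M + 1) (N - 1)"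
    unfolding qconv_def infsum_cmult_right'[symmetric] termwise
    by (intro infsum_add qconv_summable)
  also have "qconv q (\<lambda>j. a j * q powi (M + 1 - j)) (M + 1) (N - 1)
      = qconv q (\<lambda>j. a (j + 1) * q powi (M - j)) M N"
    by (subst qconv_shift[of q _ _ _ 1]) simp
  finally show ?thesis .
qed

lemma qconv_add_1_right:
  "(1 - q powi (M + N + 1)) * qconv q a M (N + 1)
    = qconv q a M N + qconv q (\<lambda>j. a (j - 1) * q powi (N + j)) M N"
proof -
  have "qconv q (\<lambda>j. a (- j)) L M = qconv q a M L" for L
    by (subst qconv_reflect) simp
  moreover have "qconv q (\<lambda>j. a (- (j + 1)) * q powi (N - j)) N M
      = qconv q (\<lambda>j. a (j - 1) * q powi (N + j)) M N"
    by (subst qconv_reflect) simp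
  ultimately show ?thesis
    using qconv_add_1_left[of N M "\<lambda>j. a (- j)"] by (simp add: add.commute)
qed

end

section \<open>The finite and infinite Jacobi triple product\<close>

lemma int_choose_two_double: "2 * int_choose_two k = k * (k - 1)"
  unfolding int_choose_two_def by (rule dvd_mult_div_cancel) auto

lemma int_choose_two_add_1: "int_choose_two (k + 1) = int_choose_two k + k"
  using int_choose_two_double[of k] int_choose_two_double[of "k + 1"] by (simp add: algebra_simps)

lemma int_choose_two_uminus: "int_choose_two (- k) = int_choose_two k + k"
  using int_choose_two_double[of k] int_choose_two_double[of "- k"] by (simp add: algebra_simps)

definition theta_term :: "complex \<Rightarrow> complex \<Rightarrow> int \<Rightarrow> complex" where
  "theta_term q z j = (- z) powi j * q powi int_choose_two j"

lemma theta_term_0 [simp]: "theta_term q z 0 = 1"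
  by (simp add: theta_term_def int_choose_two_def)

context nome
begin

lemma theta_term_add_1:
  assumes "z \<noteq> 0"
  shows "theta_term q z (j + 1) * q powi (M - j) = - (z * q powi M) * theta_term q z j"
  using assms q_nonzero
  by (simp add: theta_term_def int_choose_two_add_1 power_int_add power_int_diff)

lemma theta_term_diff_1:
  assumes "z \<noteq> 0"
  shows "theta_term q z (j - 1) * q powi (N + j) = - (q / z * q powi N) * theta_term q z j"
proof -
  have "q * theta_term q z j = - (z * q powi j * theta_term q z (j - 1))"
    using theta_term_add_1[OF assms, of "j - 1" "j - 1"] q_nonzero
    by (simp add: power_int_diff field_simps)
  then have "theta_term q z (j - 1) * q powi j = - (q / z) * theta_term q z j"
    using assms by (simp add: field_simps)
  then show ?thesis
    using q_nonzero by (simp add: power_int_add) (simp add: mult_ac)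
qed

lemma theta_term_uminus: "z \<noteq> 0 \<Longrightarrow> theta_term q z (- j) = theta_term q (q / z) j"
  using q_nonzero
  by (simp add: theta_term_def int_choose_two_uminus power_int_add power_int_minus
      power_int_divide_distrib power_int_minus_left field_simps)

lemma theta_term_square: "theta_term (q\<^sup>2) (- (y * q)) j = y powi j * q powi (j * j)"
proof -
  have "q powi j * (q\<^sup>2) powi int_choose_two j = q powi (j + 2 * int_choose_two j)"
    using q_nonzero by (simp add: power_int_add power_int_power)
  also have "j + 2 * int_choose_two j = j * j"
    using int_choose_two_double[of j] by (simp add: algebra_simps)
  finally show ?thesis
    by (simp add: theta_term_def power_int_mult_distrib)
qed

lemma theta_term_mult_quadratic:
  "theta_term q z j * q powi (int k * (j * j + int e * j))
    = theta_term (q ^ (2 * k + 1)) (z * q ^ (k * (e + 1))) j"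
proof -
  have "int_choose_two j + int k * (j * j + int e * j)
      = int (k * (e + 1)) * j + int (2 * k + 1) * int_choose_two j"
    using arg_cong[OF int_choose_two_double[of j], of "\<lambda>x. int k * x"] by (simp add: algebra_simps)
  then have "q powi int_choose_two j * q powi (int k * (j * j + int e * j))
      = (q ^ (k * (e + 1))) powi j * (q ^ (2 * k + 1)) powi int_choose_two j"
    using q_nonzero by (simp only: power_int_power simp_thms flip: power_int_add)
  moreover have "(- (z * x)) powi j = (- z) powi j * x powi j" for x
    by (simp flip: power_int_mult_distrib)
  ultimately show ?thesis
    by (simp add: theta_term_def)
qed

lemma finite_Jacobi_triple_product:
  assumes "z \<noteq> 0"
  shows "qconv q (theta_term q z) (int M) (int N)
    = inv_qfact q (int (M + N)) * qpoch z q M * qpoch (q / z) q N"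
proof (induction M)
  case 0
  show ?case
  proof (induction N)
    case (Suc N)
    have "(1 - q powi (int N + 1)) * qconv q (theta_term q z) 0 (int N + 1)
        = (1 - q / z * q ^ N) * qconv q (theta_term q z) 0 (int N)"
      using qconv_add_1_right[of 0 "int N" "theta_term q z"]
      unfolding theta_term_diff_1[OF assms] qconv_cmult by (simp add: algebra_simps)
    also have "\<dots> = (1 - q powi (int N + 1)) * (inv_qfact q (int N + 1) * qpoch (q / z) q (Suc N))"
      using Suc inv_qfact_diff_1[OF norm_q_less_1, of "int N + 1"] by (simp add: qpoch_Suc)
    finally show ?case
      using powi_neq_one[OF norm_q_less_1, of "int N + 1"] by (simp add: add.commute)
  qed (simp add: qconv_0_0)
next
  case (Suc M)
  let ?n = "int (M + N) + 1"
  have "(1 - q powi ?n) * qconv q (theta_term q z) (int M + 1) (int N)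
      = (1 - z * q ^ M) * qconv q (theta_term q z) (int M) (int N)"
    using qconv_add_1_left[of "int M" "int N" "theta_term q z"]
    unfolding theta_term_add_1[OF assms] qconv_cmult by (simp add: algebra_simps)
  also have "\<dots> = (1 - q powi ?n) * (inv_qfact q ?n * qpoch z q (Suc M) * qpoch (q / z) q N)"
    using Suc inv_qfact_diff_1[OF norm_q_less_1, of ?n] by (simp add: qpoch_Suc)
  finally show ?case
    using powi_neq_one[OF norm_q_less_1, of ?n] by (simp add: add_ac)
qed

lemma summable_theta_term:
  assumes "z \<noteq> 0"
  shows "summable (\<lambda>n. norm (theta_term q z (int n)))"
proof -
  have "(\<lambda>n. norm z * norm q ^ n) \<longlonglongrightarrow> norm z * 0"
    using norm_q_less_1 by (intro tendsto_mult_left LIMSEQ_power_zero) simp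
  then have "\<forall>\<^sub>F n in sequentially. norm z * norm q ^ n < 1 / 2"
    by (rule order_tendstoD) simp
  then obtain n0 where ratio: "norm z * norm q ^ n \<le> 1 / 2" if "n \<ge> n0" for n
    unfolding eventually_sequentially by (meson less_imp_le)
  show ?thesis
  proof (rule summable_ratio_test)
    fix n assume "n \<ge> n0"
    have "norm (theta_term q z (int (Suc n)))
        = norm z * norm q ^ n * norm (theta_term q z (int n))"
      using theta_term_add_1[OF assms, of "int n" "int n"]
      by (simp add: norm_mult norm_power add.commute)
    also have "\<dots> \<le> 1 / 2 * norm (theta_term q z (int n))"
      by (intro mult_right_mono ratio \<open>n \<ge> n0\<close>) simp
    finally show "norm (norm (theta_term q z (int (Suc n))))
        \<le> 1 / 2 * norm (norm (theta_term q z (int n)))"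
      by simp
  qed simp
qed

lemma theta_term_abs_summable:
  assumes "z \<noteq> 0"
  shows "(\<lambda>j. norm (theta_term q z j)) summable_on UNIV"
proof (rule summable_on_int)
  show "(\<lambda>n. norm (theta_term q z (int n))) summable_on UNIV"
    by (intro summable_nonneg_imp_summable_on summable_theta_term assms) simp
  have "q / z \<noteq> 0" using assms q_nonzero by simp
  then show "(\<lambda>n. norm (theta_term q z (- int n))) summable_on UNIV"
    unfolding theta_term_uminus[OF assms]
    by (intro summable_nonneg_imp_summable_on summable_theta_term) simp_all
qed

lemma qconv_tendsto:
  assumes abs_summable: "(\<lambda>j. norm (a j)) summable_on UNIV"
    and lim_left: "\<And>j. (\<lambda>n. inv_qfact q (M n - j)) \<longlonglongrightarrow> u j"
    and lim_right: "\<And>j. (\<lambda>n. inv_qfact q (N n + j)) \<longlonglongrightarrow> v j"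
  shows "(\<lambda>n. qconv q a (M n) (N n)) \<longlonglongrightarrow> (\<Sum>\<^sub>\<infinity>j. a j * u j * v j)"
proof -
  obtain C where C: "C > 0" "\<And>k. norm (inv_qfact q k) \<le> C"
    using inv_qfact_bounded[OF norm_q_less_1] by blast
  show ?thesis
    unfolding qconv_def
  proof (rule tendsto_infsum_dominated[where M = "\<lambda>j. norm (a j) * (C * C)"])
    show "norm (a j * inv_qfact q (M n - j) * inv_qfact q (N n + j)) \<le> norm (a j) * (C * C)" for n j
      unfolding norm_mult mult.assoc using C by (intro mult_left_mono mult_mono) auto
    show "(\<lambda>j. norm (a j) * (C * C)) summable_on UNIV"
      by (intro summable_on_cmult_left abs_summable)
  qed (intro tendsto_mult tendsto_const lim_left lim_right sequentially_bot)+
qed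

lemma qconv_diagonal_tendsto:
  assumes "(\<lambda>j. norm (a j)) summable_on UNIV"
  shows "(\<lambda>N. qconv q a (int N) (int N + e)) \<longlonglongrightarrow> infsum a UNIV / (qpoch_inf q q)\<^sup>2"
proof -
  have "(\<lambda>N. qconv q a (int N) (int N + e))
      \<longlonglongrightarrow> (\<Sum>\<^sub>\<infinity>j. a j * (1 / qpoch_inf q q) * (1 / qpoch_inf q q))"
    using inv_qfact_shift_tendsto[OF norm_q_less_1]
    by (intro qconv_tendsto assms) (simp_all add: add.assoc flip: add_uminus_conv_diff)
  also have "(\<Sum>\<^sub>\<infinity>j. a j * (1 / qpoch_inf q q) * (1 / qpoch_inf q q))
      = infsum a UNIV / (qpoch_inf q q)\<^sup>2"
    by (simp add: infsum_cmult_left' power2_eq_square divide_inverse mult.assoc)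
  finally show ?thesis .
qed

lemma has_sum_of_qconv_tendsto:
  assumes abs_summable: "(\<lambda>j. norm (a j)) summable_on UNIV"
    and lim: "(\<lambda>N. qconv q a (int N) 0) \<longlonglongrightarrow> L"
  shows "((\<lambda>n. a (int n) / qpoch q q n) has_sum L * qpoch_inf q q) UNIV"
proof -
  let ?b = "\<lambda>j. a j * inv_qfact q j"
  obtain C where C: "\<And>k. norm (inv_qfact q k) \<le> C"
    using inv_qfact_bounded[OF norm_q_less_1] by blast
  have "(\<lambda>j. norm (?b j)) summable_on UNIV"
    by (rule Infinite_Sum.abs_summable_on_comparison_test'
          [OF summable_on_cmult_left[OF abs_summable, of C]])
       (simp add: norm_mult C mult_left_mono)
  then have "(?b has_sum infsum ?b UNIV) UNIV"
    by (rule has_sum_infsum[OF abs_summable_summable])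
  also have "?this \<longleftrightarrow> (?b has_sum infsum ?b UNIV) (range int)"
  proof (rule has_sum_cong_neutral)
    fix j assume "j \<in> UNIV - range int"
    then have "j < 0" by (metis DiffD2 int_nat_eq linorder_not_less rangeI)
    then show "?b j = 0" by simp
  qed auto
  also have "\<dots> \<longleftrightarrow> ((\<lambda>n. a (int n) / qpoch q q n) has_sum infsum ?b UNIV) UNIV"
    by (subst has_sum_reindex) (auto simp: o_def inv_qfact_of_nat)
  finally have series: "((\<lambda>n. a (int n) / qpoch q q n) has_sum infsum ?b UNIV) UNIV" .
  have "(\<lambda>N. qconv q a (int N) 0) \<longlonglongrightarrow> (\<Sum>\<^sub>\<infinity>j. a j * (1 / qpoch_inf q q) * inv_qfact q j)"
    using inv_qfact_shift_tendsto[OF norm_q_less_1]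
    by (intro qconv_tendsto abs_summable) (simp_all flip: add_uminus_conv_diff)
  then have "L = (\<Sum>\<^sub>\<infinity>j. a j * (1 / qpoch_inf q q) * inv_qfact q j)"
    by (rule LIMSEQ_unique[OF lim])
  also have "\<dots> = infsum ?b UNIV * (1 / qpoch_inf q q)"
    by (subst infsum_cmult_left'[symmetric]) (simp add: mult_ac)
  finally show ?thesis
    using series qpoch_inf_q_nonzero by simp
qed

theorem Jacobi_triple_product:
  assumes "z \<noteq> 0"
  shows "infsum (theta_term q z) UNIV = qpoch_inf q q * qpoch_inf z q * qpoch_inf (q / z) q"
proof -
  have "(\<lambda>N. inv_qfact q (int (N + N))) \<longlonglongrightarrow> 1 / qpoch_inf q q"
    using filterlim_compose[OF inv_qfact_shift_tendsto[OF norm_q_less_1, of 0],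
        of "\<lambda>N. N + N"] filterlim_subseq[of "\<lambda>N::nat. N + N"]
    by (simp add: strict_mono_def)
  then have "(\<lambda>N. qconv q (theta_term q z) (int N) (int N))
      \<longlonglongrightarrow> 1 / qpoch_inf q q * qpoch_inf z q * qpoch_inf (q / z) q"
    unfolding finite_Jacobi_triple_product[OF assms]
    by (intro tendsto_mult qpoch_tendsto norm_q_less_1)
  moreover have "(\<lambda>N. qconv q (theta_term q z) (int N) (int N))
      \<longlonglongrightarrow> infsum (theta_term q z) UNIV / (qpoch_inf q q)\<^sup>2"
    using qconv_diagonal_tendsto[OF theta_term_abs_summable[OF assms], of 0] by simp
  ultimately have "infsum (theta_term q z) UNIV / (qpoch_inf q q)\<^sup>2
     = 1 / qpoch_inf q q * qpoch_inf z q * qpoch_inf (q / z) q"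
    by (rule LIMSEQ_unique[rotated])
  then show ?thesis
    using qpoch_inf_q_nonzero by (simp add: field_simps power2_eq_square)
qed

theorem Euler_qpoch_inf:
  assumes "z \<noteq> 0"
  shows "((\<lambda>n. theta_term q z (int n) / qpoch q q n) has_sum qpoch_inf z q) UNIV"
proof -
  have "(\<lambda>N. inv_qfact q (int N + 0) * qpoch z q N) \<longlonglongrightarrow> 1 / qpoch_inf q q * qpoch_inf z q"
    by (intro tendsto_mult qpoch_tendsto inv_qfact_shift_tendsto norm_q_less_1)
  then have "(\<lambda>N. qconv q (theta_term q z) (int N) 0) \<longlonglongrightarrow> qpoch_inf z q / qpoch_inf q q"
    using finite_Jacobi_triple_product[OF assms, of _ 0] by simp
  from has_sum_of_qconv_tendsto[OF theta_term_abs_summable[OF assms] this]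
  show ?thesis using qpoch_inf_q_nonzero by simp
qed

end

section \<open>Bailey's lemma and the Rogers--Ramanujan identities\<close>

text \<open>Bailey pairs relative to \<open>q\<^sup>e\<close>, with the sequence \<open>\<alpha>\<close> spread over all integers: the
  classical \<open>\<alpha>\<^sub>j\<close> with \<open>j \<ge> 0\<close> collects the terms at \<open>j\<close> and \<open>- j - e\<close>, where the kernel takes the
  same value.\<close>

definition Bailey_pair :: "complex \<Rightarrow> int \<Rightarrow> (int \<Rightarrow> complex) \<Rightarrow> (int \<Rightarrow> complex) \<Rightarrow> bool" where
  "Bailey_pair q e \<alpha> \<beta> \<longleftrightarrow> (\<forall>N. \<beta> N = qconv q \<alpha> N (N + e))"

context nome
begin

lemma q_Vandermonde:
  "qconv q (\<lambda>t. q powi (t * t + a * t) * inv_qfact q (t + a)) (int M) 0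
    = inv_qfact q (int M) * inv_qfact q (int M + a)"
proof (induction M arbitrary: a)
  case 0
  show ?case by (simp add: qconv_0_0)
next
  case (Suc M)
  let ?w = "\<lambda>a t. q powi (t * t + a * t) * inv_qfact q (t + a)"
  let ?m = "int M"
  have "?w a (t + 1) * q powi (?m - t) = q powi (?m + 1 + a) * ?w (a + 1) t" for t
    using q_nonzero by (simp add: algebra_simps flip: power_int_add)
  then have "(1 - q powi (?m + 1)) * qconv q (?w a) (?m + 1) 0
      = qconv q (?w a) ?m 0 + q powi (?m + 1 + a) * qconv q (?w (a + 1)) ?m 0"
    using qconv_add_1_left[of ?m 0 "?w a"] by (simp add: qconv_cmult)
  also have "\<dots> = inv_qfact q ?m * (inv_qfact q (?m + a)
      + q powi (?m + 1 + a) * inv_qfact q (?m + 1 + a))"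
    by (simp only: Suc) (simp add: algebra_simps)
  also have "\<dots> = inv_qfact q ?m * inv_qfact q (?m + 1 + a)"
    using inv_qfact_diff_1[OF norm_q_less_1, of "?m + 1 + a"] by (simp add: algebra_simps)
  also have "inv_qfact q ?m = (1 - q powi (?m + 1)) * inv_qfact q (?m + 1)"
    using inv_qfact_diff_1[OF norm_q_less_1, of "?m + 1"] by simp
  finally show ?case
    using powi_neq_one[OF norm_q_less_1, of "?m + 1"] by (simp add: add_ac)
qed

lemma Bailey_kernel:
  "(\<Sum>\<^sub>\<infinity>s. q powi (s * s + e * s) * inv_qfact q (N - s)
      * (inv_qfact q (s - j) * inv_qfact q (s + e + j)))
    = q powi (j * j + e * j) * inv_qfact q (N - j) * inv_qfact q (N + e + j)"
proof -
  let ?w = "\<lambda>a t. q powi (t * t + a * t) * inv_qfact q (t + a)"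
  have shifted: "q powi ((s + j) * (s + j) + e * (s + j)) * inv_qfact q (s + j + e + j)
      = q powi (j * j + e * j) * ?w (2 * j + e) s" for s
    using q_nonzero by (simp add: algebra_simps flip: power_int_add)
  have "(\<Sum>\<^sub>\<infinity>s. q powi (s * s + e * s) * inv_qfact q (N - s)
        * (inv_qfact q (s - j) * inv_qfact q (s + e + j)))
     = qconv q (\<lambda>s. q powi (s * s + e * s) * inv_qfact q (s + e + j)) N (- j)"
    unfolding qconv_def by (rule infsum_cong) (simp add: mult_ac)
  also have "\<dots> = q powi (j * j + e * j) * qconv q (?w (2 * j + e)) (N - j) 0"
    unfolding qconv_cmult[symmetric] shifted[symmetric] by (subst qconv_shift[of q _ _ _ j]) simp
  also have "\<dots> = q powi (j * j + e * j) * inv_qfact q (N - j) * inv_qfact q (N + e + j)"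
  proof (cases "j \<le> N")
    case True
    then obtain M where M: "N - j = int M" by (metis diff_ge_0_iff_ge nonneg_int_cases)
    then have "N + e + j = int M + (2 * j + e)" by simp
    then show ?thesis by (simp only: M q_Vandermonde mult.assoc)
  qed (simp add: qconv_eq_0)
  finally show ?thesis .
qed

theorem Bailey_lemma:
  assumes "Bailey_pair q e \<alpha> \<beta>"
  shows "Bailey_pair q e (\<lambda>j. \<alpha> j * q powi (j * j + e * j))
    (\<lambda>N. \<Sum>\<^sub>\<infinity>s. q powi (s * s + e * s) * inv_qfact q (N - s) * \<beta> s)"
  unfolding Bailey_pair_def
proof
  fix N
  let ?f = "\<lambda>s j. q powi (s * s + e * s) * inv_qfact q (N - s)
      * (\<alpha> j * (inv_qfact q (s - j) * inv_qfact q (s + e + j)))"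
  have "(\<lambda>(s, j). ?f s j) summable_on UNIV \<times> UNIV"
  proof (rule finite_nonzero_values_imp_summable_on)
    have "{x \<in> UNIV \<times> UNIV. (case x of (s, j) \<Rightarrow> ?f s j) \<noteq> 0} \<subseteq> {- \<bar>e\<bar>..N} \<times> {- N - e..N}"
      by (auto simp: inv_qfact_def split: if_splits)
    then show "finite {x \<in> UNIV \<times> UNIV. (case x of (s, j) \<Rightarrow> ?f s j) \<noteq> 0}"
      by (rule finite_subset) auto
  qed
  then have "(\<Sum>\<^sub>\<infinity>s. \<Sum>\<^sub>\<infinity>j. ?f s j) = (\<Sum>\<^sub>\<infinity>j. \<Sum>\<^sub>\<infinity>s. ?f s j)"
    by (rule infsum_swap_banach)
  moreover have "(\<Sum>\<^sub>\<infinity>j. ?f s j) = q powi (s * s + e * s) * inv_qfact q (N - s) * \<beta> s" for s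
    using assms unfolding Bailey_pair_def qconv_def by (simp add: infsum_cmult_right' mult.assoc)
  moreover have "(\<Sum>\<^sub>\<infinity>s. ?f s j)
      = \<alpha> j * q powi (j * j + e * j) * inv_qfact q (N - j) * inv_qfact q (N + e + j)" for j
  proof -
    have "(\<Sum>\<^sub>\<infinity>s. ?f s j) = \<alpha> j * (\<Sum>\<^sub>\<infinity>s. q powi (s * s + e * s) * inv_qfact q (N - s)
        * (inv_qfact q (s - j) * inv_qfact q (s + e + j)))"
      by (subst infsum_cmult_right'[symmetric]) (simp add: mult_ac)
    then show ?thesis unfolding Bailey_kernel by (simp add: mult_ac)
  qed
  ultimately show "(\<Sum>\<^sub>\<infinity>s. q powi (s * s + e * s) * inv_qfact q (N - s) * \<beta> s)
      = qconv q (\<lambda>j. \<alpha> j * q powi (j * j + e * j)) N (N + e)"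
    by (simp add: qconv_def)
qed

lemma unit_Bailey_pair:
  assumes "e \<le> 1"
  shows "Bailey_pair q (int e) (theta_term q 1) (\<lambda>N. if N = 0 then 1 else 0)"
proof -
  have "qconv q (theta_term q 1) N (N + int e) = (if N = 0 then 1 else 0)" for N
  proof (cases "N < 0")
    case True
    then show ?thesis using assms by (simp add: qconv_eq_0)
  next
    case False
    then obtain n where n: "N = int n" by (metis nonneg_int_cases linorder_not_less)
    have "qpoch 1 q n = 0" if "n > 0"
      using that by (auto simp: qpoch_def intro!: bexI[of _ 0])
    then show ?thesis
      using finite_Jacobi_triple_product[of 1 n "n + e"]
        qpoch_nonzero[OF norm_q_less_1 norm_q_less_1, of e]
      by (auto simp: n inv_qfact_of_nat)
  qed
  then show ?thesis by (simp add: Bailey_pair_def)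
qed

lemma finite_Rogers_Ramanujan:
  assumes "e \<le> 1"
  shows "qconv q (\<lambda>s. q powi (s * s + int e * s)) N 0
    = qconv q (theta_term (q ^ 5) (q ^ (2 + 2 * e))) N (N + int e)"
proof -
  let ?w = "\<lambda>s. q powi (s * s + int e * s)"
  have "(\<Sum>\<^sub>\<infinity>s. ?w s * inv_qfact q (M - s) * (if s = 0 then 1 else 0))
      = (\<Sum>\<^sub>\<infinity>s\<in>{0::int}. inv_qfact q M)" for M
    by (rule infsum_cong_neutral) auto
  then have "Bailey_pair q (int e) (\<lambda>j. theta_term q 1 j * ?w j) (inv_qfact q)"
    using Bailey_lemma[OF unit_Bailey_pair[OF assms]] by simp
  from Bailey_lemma[OF this]
  have "qconv q ?w N 0 = qconv q (\<lambda>j. theta_term q 1 j * ?w j * ?w j) N (N + int e)"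
    by (simp add: Bailey_pair_def qconv_def)
  also have "(\<lambda>j. theta_term q 1 j * ?w j * ?w j) = theta_term (q ^ 5) (q ^ (2 + 2 * e))"
  proof
    fix j
    have "?w j * ?w j = q powi (int 2 * (j * j + int e * j))"
      using q_nonzero by (simp only: of_nat_numeral mult_2 power_int_add simp_thms)
    moreover have "q ^ (2 * 2 + 1) = q ^ 5" "1 * q ^ (2 * (e + 1)) = q ^ (2 + 2 * e)"
      by simp_all
    ultimately show "theta_term q 1 j * ?w j * ?w j = theta_term (q ^ 5) (q ^ (2 + 2 * e)) j"
      using theta_term_mult_quadratic[of 1 j 2 e] by (simp only: mult.assoc)
  qed
  finally show ?thesis .
qed

lemma Rogers_Ramanujan_theta:
  assumes "e \<le> 1"
  shows "((\<lambda>n. q ^ (n * n + e * n) / qpoch q q n) has_sum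
    qpoch_inf (q ^ 5) (q ^ 5) * qpoch_inf (q ^ (2 + 2 * e)) (q ^ 5)
      * qpoch_inf (q ^ (3 - 2 * e)) (q ^ 5) / qpoch_inf q q) UNIV"
proof -
  interpret sq: nome "q\<^sup>2" by (rule nome_power) simp
  interpret fifth: nome "q ^ 5" by (rule nome_power) simp
  let ?w = "\<lambda>s. q powi (s * s + int e * s)" and ?z = "q ^ (2 + 2 * e)"
  have z_nonzero: "?z \<noteq> 0" using q_nonzero by simp
  have w_eq_theta_term: "?w s = theta_term (q\<^sup>2) (- (q ^ e * q)) s" for s
    using q_nonzero unfolding theta_term_square
    by (simp add: power_int_power power_int_add mult.commute)
  have "(\<lambda>s. norm (?w s)) summable_on UNIV"
    unfolding w_eq_theta_term by (rule sq.theta_term_abs_summable) (simp add: q_nonzero)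
  moreover have "(\<lambda>N. qconv q ?w (int N) 0)
      \<longlonglongrightarrow> infsum (theta_term (q ^ 5) ?z) UNIV / (qpoch_inf q q)\<^sup>2"
    unfolding finite_Rogers_Ramanujan[OF assms]
    by (intro qconv_diagonal_tendsto fifth.theta_term_abs_summable z_nonzero)
  ultimately have "((\<lambda>n. ?w (int n) / qpoch q q n) has_sum
      infsum (theta_term (q ^ 5) ?z) UNIV / (qpoch_inf q q)\<^sup>2 * qpoch_inf q q) UNIV"
    by (rule has_sum_of_qconv_tendsto)
  moreover have "?w (int n) = q ^ (n * n + e * n)" for n
    by (simp flip: of_nat_mult of_nat_add)
  moreover have "q ^ 5 = q ^ (3 - 2 * e) * ?z"
    using assms by (simp only: flip: power_add) simp
  then have "q ^ 5 / ?z = q ^ (3 - 2 * e)"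
    using z_nonzero by (simp only: nonzero_mult_div_cancel_right simp_thms)
  ultimately show ?thesis
    using qpoch_inf_q_nonzero
    by (simp only: fifth.Jacobi_triple_product[OF z_nonzero]) (simp add: power2_eq_square)
qed

lemma qpoch_inf_q_quintisection:
  "qpoch_inf q q = qpoch_inf q (q ^ 5) * qpoch_inf (q ^ 2) (q ^ 5) * qpoch_inf (q ^ 3) (q ^ 5)
    * qpoch_inf (q ^ 4) (q ^ 5) * qpoch_inf (q ^ 5) (q ^ 5)"
  using qpoch_inf_multisection[OF norm_q_less_1, of 5 q]
  by (simp add: eval_nat_numeral lessThan_Suc mult_ac)

lemma qpoch_inf_power_nonzero: "k > 0 \<Longrightarrow> l > 0 \<Longrightarrow> qpoch_inf (q ^ k) (q ^ l) \<noteq> 0"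
  using norm_q_less_1 by (intro qpoch_inf_nonzero) (simp_all add: norm_power power_less_one_iff)

theorem Rogers_Ramanujan_1:
  "((\<lambda>n. q ^ (n * n) / qpoch q q n) has_sum 1 / qpochs_inf [q, q ^ 4] (q ^ 5)) UNIV"
  using Rogers_Ramanujan_theta[of 0] qpoch_inf_power_nonzero[of _ 5]
  by (simp add: qpoch_inf_q_quintisection qpochs_inf_def)

theorem Rogers_Ramanujan_2:
  "((\<lambda>n. q ^ (n * n + n) / qpoch q q n) has_sum 1 / qpochs_inf [q ^ 2, q ^ 3] (q ^ 5)) UNIV"
  using Rogers_Ramanujan_theta[of 1] qpoch_inf_power_nonzero[of _ 5] qpoch_inf_power_nonzero[of 1 5]
  by (simp add: qpoch_inf_q_quintisection qpochs_inf_def)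

end

section \<open>Gauss' alternating sum and Rogers--Szego polynomials\<close>

text \<open>The homogeneous Rogers--Szego polynomial divided by \<open>(q;q)\<^sub>N\<close>.\<close>

definition rogers_szego :: "complex \<Rightarrow> complex \<Rightarrow> complex \<Rightarrow> int \<Rightarrow> complex" where
  "rogers_szego q x y N = qconv q (\<lambda>j. x powi (N - j) * y powi j) N 0"

lemma rogers_szego_0 [simp]: "rogers_szego q x y 0 = 1"
  by (simp add: rogers_szego_def qconv_0_0)

lemma rogers_szego_neg [simp]: "N < 0 \<Longrightarrow> rogers_szego q x y N = 0"
  by (simp add: rogers_szego_def qconv_eq_0)

lemma rogers_szego_commute: "rogers_szego q x y N = rogers_szego q y x N"
  unfolding rogers_szego_def by (subst qconv_flip) (simp add: mult.commute)

context nome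
begin

lemma inv_qfact_square_diff_1:
  "inv_qfact (q\<^sup>2) (k - 1) = (1 - q powi (2 * k)) * inv_qfact (q\<^sup>2) k"
  using inv_qfact_diff_1[of "q\<^sup>2" k] nome.norm_q_less_1[OF nome_power, of 2]
  by (simp add: power_int_power)

lemma qconv_Gauss:
  "qconv q (\<lambda>j. (- 1) powi j * q powi (j * j)) (int K) (int K) = inv_qfact (q\<^sup>2) (int K)"
proof (induction K)
  case 0
  show ?case by (simp add: qconv_0_0)
next
  case (Suc K)
  let ?a = "\<lambda>j. (- 1) powi j * q powi (j * j)"
  let ?k = "int K"
  have "?a (j - 1) * q powi (?k + j) = - 1 * (?a j * q powi (?k + 1 - j))" for j
  proof -
    have "q powi ((j - 1) * (j - 1)) * q powi (?k + j) = q powi (j * j) * q powi (?k + 1 - j)"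
      using q_nonzero by (simp add: algebra_simps flip: power_int_add)
    then show ?thesis by (simp add: power_int_diff)
  qed
  then have "qconv q (\<lambda>j. ?a (j - 1) * q powi (?k + j)) (?k + 1) ?k
      = - (qconv q ?a (?k + 1) ?k - qconv q ?a ?k ?k)"
    using qconv_cmult[of q "- 1"] qconv_weight_left[OF norm_q_less_1, of ?a "?k + 1" ?k] by simp
  then have "(1 - q powi (2 * (?k + 1))) * qconv q ?a (?k + 1) (?k + 1) = qconv q ?a ?k ?k"
    using qconv_add_1_right[of "?k + 1" ?k ?a] by (simp add: algebra_simps)
  also have "\<dots> = (1 - q powi (2 * (?k + 1))) * inv_qfact (q\<^sup>2) (?k + 1)"
    using Suc inv_qfact_square_diff_1[of "?k + 1"] by simp
  finally show ?case
    using powi_neq_one[OF norm_q_less_1, of "2 * (?k + 1)"] by (simp add: add.commute)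
qed

lemma rogers_szego_add_1:
  assumes "x \<noteq> 0" "y \<noteq> 0"
  shows "(1 - q powi (N + 1)) * rogers_szego q x y (N + 1)
    = (x + y) * rogers_szego q x y N - x * y * rogers_szego q x y (N - 1)"
proof -
  let ?a = "\<lambda>N j. x powi (N - j) * y powi j"
  have raise_degree: "?a (N + 1) j = x * ?a N j" for N j
    using assms by (simp add: power_int_add power_int_diff)
  have raise_index: "?a (N + 1) (j + 1) * q powi (N - j) = y * (?a N j * q powi (N - j))" for j
    using assms by (simp add: power_int_add)
  have "(1 - q powi (N + 1)) * rogers_szego q x y (N + 1)
      = qconv q (?a (N + 1)) N 0 + qconv q (\<lambda>j. ?a (N + 1) (j + 1) * q powi (N - j)) N 0"
    unfolding rogers_szego_def using qconv_add_1_left[of N 0 "?a (N + 1)"] by simp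
  also have "\<dots> = x * rogers_szego q x y N + y * qconv q (\<lambda>j. ?a N j * q powi (N - j)) N 0"
    unfolding raise_index unfolding raise_degree qconv_cmult rogers_szego_def ..
  also have "qconv q (\<lambda>j. ?a N j * q powi (N - j)) N 0
      = rogers_szego q x y N - x * rogers_szego q x y (N - 1)"
    unfolding qconv_weight_left[OF norm_q_less_1] rogers_szego_def qconv_cmult[symmetric]
      raise_degree[symmetric] by simp
  finally show ?thesis by (simp add: algebra_simps)
qed

lemma rogers_szego_alternating:
  "rogers_szego q 1 (- 1) (int N) = (if even N then inv_qfact (q\<^sup>2) (int (N div 2)) else 0)"
proof (induction N rule: induct_nat_012)
  case 1
  show ?case
    using rogers_szego_add_1[of 1 "- 1" 0] powi_neq_one[OF norm_q_less_1, of 1] by simp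
next
  case (ge2 n)
  have recurrence: "(1 - q powi (int n + 2)) * rogers_szego q 1 (- 1) (int n + 2)
      = rogers_szego q 1 (- 1) (int n)"
    using rogers_szego_add_1[of 1 "- 1" "int n + 1"] by (simp add: add_ac)
  have powi_neq_1: "q powi (int n + 2) \<noteq> 1"
    by (intro powi_neq_one norm_q_less_1) simp
  show ?case
  proof (cases "even n")
    case True
    then obtain k where k: "n = 2 * k" by blast
    have "(1 - q powi (int n + 2)) * rogers_szego q 1 (- 1) (int n + 2)
        = (1 - q powi (int n + 2)) * inv_qfact (q\<^sup>2) (int k + 1)"
      using recurrence ge2(1) inv_qfact_square_diff_1[of "int k + 1"] by (simp add: k)
    then show ?thesis
      using powi_neq_1 by (simp add: k add.commute)
  qed (use recurrence powi_neq_1 ge2(1) in \<open>simp add: add.commute\<close>)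
qed simp

lemma rogers_szego_base_square:
  assumes "z \<noteq> 0"
  shows "rogers_szego (q\<^sup>2) z (z * q) (int N) = z ^ N * inv_qfact q (int N)"
proof -
  interpret sq: nome "q\<^sup>2" by (rule nome_power) simp
  have recurrence: "(1 - q powi (2 * (N + 1))) * rogers_szego (q\<^sup>2) z (z * q) (N + 1)
      = z * (1 + q) * rogers_szego (q\<^sup>2) z (z * q) N
        - z\<^sup>2 * q * rogers_szego (q\<^sup>2) z (z * q) (N - 1)" for N
    using sq.rogers_szego_add_1[of z "z * q" N] assms q_nonzero
    by (simp add: power_int_power) (simp add: algebra_simps power2_eq_square)
  have "rogers_szego (q\<^sup>2) z (z * q) (int N - 1) = z powi (int N - 1) * inv_qfact q (int N - 1)
    \<and> rogers_szego (q\<^sup>2) z (z * q) (int N) = z ^ N * inv_qfact q (int N)"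
  proof (induction N)
    case (Suc N)
    have inv_qfact_pred: "inv_qfact q (int N - 1) = (1 - q ^ N) * inv_qfact q (int N)"
      "inv_qfact q (int N) = (1 - q ^ Suc N) * inv_qfact q (int N + 1)"
      using inv_qfact_diff_1[OF norm_q_less_1, of "int N"]
        inv_qfact_diff_1[OF norm_q_less_1, of "int N + 1"] q_nonzero
      by (simp_all add: power_int_add)
    have "z\<^sup>2 * z powi (int N - 1) = z * z ^ N"
      using assms by (simp add: power_int_diff power2_eq_square)
    then have "(1 - q powi (2 * (int N + 1))) * rogers_szego (q\<^sup>2) z (z * q) (int N + 1)
        = z * z ^ N * ((1 + q) * inv_qfact q (int N) - q * inv_qfact q (int N - 1))"
      using Suc unfolding recurrence by (simp add: algebra_simps)
    also have "\<dots> = (1 - q powi (2 * (int N + 1))) * (z ^ Suc N * inv_qfact q (int N + 1))"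
      unfolding inv_qfact_pred using q_nonzero
      by (simp add: power_int_add power_int_mult power2_eq_square algebra_simps)
    finally show ?case
      using Suc powi_neq_one[OF norm_q_less_1, of "2 * (int N + 1)"] by (simp add: add.commute)
  qed simp
  then show ?thesis by simp
qed

lemma qconv_signed:
  assumes r: "r ^ 4 = q"
  shows "qconv q (\<lambda>j. (- 1) powi int_choose_two (int N - 2 * j) * r powi (int N - 2 * j)\<^sup>2)
      (int N) 0
    = (if even N then inv_qfact (q\<^sup>2) (int (N div 2)) else 0)"
proof -
  let ?c = "\<lambda>d. (- 1) powi int_choose_two d * r powi d\<^sup>2"
  show ?thesis
  proof (cases "even N")
    case True
    then obtain K where K: "N = 2 * K" by blast
    have "?c (int N - 2 * (j + int K)) = (- 1) powi j * q powi (j * j)" for j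
    proof -
      have "int_choose_two (- (2 * j)) = j * (2 * j + 1)"
        using int_choose_two_double[of "- (2 * j)"] by (simp add: algebra_simps)
      then have "(- 1 :: complex) powi int_choose_two (- (2 * j)) = (- 1) powi j"
        by (simp add: power_int_minus_left)
      moreover have "r powi (- (2 * j))\<^sup>2 = q powi (j * j)"
        unfolding r[symmetric] power_int_power by (simp add: power2_eq_square)
      ultimately show ?thesis by (simp add: K)
    qed
    then have "qconv q (\<lambda>j. ?c (int N - 2 * j)) (int N) 0
        = qconv q (\<lambda>j. (- 1) powi j * q powi (j * j)) (int K) (int K)"
      by (subst qconv_shift[of q _ _ _ "int K"]) (simp add: K)
    then show ?thesis by (simp add: qconv_Gauss K)
  next
    case False
    have "?c (int N - 2 * (int N - j)) = - 1 * ?c (int N - 2 * j)" for j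
      using False int_choose_two_uminus[of "int N - 2 * j"]
      by (simp add: power_int_add power2_commute)
    then have "qconv q (\<lambda>j. ?c (int N - 2 * j)) (int N) 0
        = - 1 * qconv q (\<lambda>j. ?c (int N - 2 * j)) (int N) 0"
      unfolding qconv_cmult[symmetric] by (subst qconv_flip) presburger
    then show ?thesis using False by simp
  qed
qed

end

section \<open>Double series\<close>

lemma double_series_summable:
  fixes q :: complex
  assumes q: "norm q < 1" and \<rho>: "0 \<le> \<rho>" "\<rho> < 1"
    and w: "\<And>n m. norm (w n m) \<le> \<rho> ^ (n + m)"
  shows "(\<lambda>(n, m). w n m / (qpoch q q m * qpoch q q n)) summable_on (UNIV :: (nat \<times> nat) set)"
proof -
  obtain C where C: "C > 0" "\<And>k. norm (inv_qfact q k) \<le> C" using inv_qfact_bounded[OF q] by blast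
  have "((\<lambda>n. \<rho> ^ n) has_sum 1 / (1 - \<rho>)) UNIV"
    using \<rho> by (intro sums_nonneg_imp_has_sum geometric_sums) auto
  then have geometric: "((\<lambda>n. c * \<rho> ^ n) has_sum c * (1 / (1 - \<rho>))) UNIV" for c
    by (rule has_sum_cmult_right)
  have "(\<lambda>(n, m). C * C * \<rho> ^ n * \<rho> ^ m) summable_on UNIV \<times> UNIV"
  proof (rule summable_on_SigmaI)
    show "((\<lambda>m. case (n, m) of (n, m) \<Rightarrow> C * C * \<rho> ^ n * \<rho> ^ m)
        has_sum (C * C * \<rho> ^ n * (1 / (1 - \<rho>)))) UNIV" for n
      using geometric[of "C * C * \<rho> ^ n"] by simp
    show "(\<lambda>n. C * C * \<rho> ^ n * (1 / (1 - \<rho>))) summable_on UNIV"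
      by (intro summable_on_cmult_left has_sum_imp_summable[OF geometric])
  qed (use C \<rho> in auto)
  note dominating = this[unfolded UNIV_Times_UNIV]
  have bound: "norm (w n m / (qpoch q q m * qpoch q q n)) \<le> C * C * \<rho> ^ n * \<rho> ^ m" for n m
  proof -
    have "norm (w n m / (qpoch q q m * qpoch q q n))
        = norm (w n m) * (norm (inv_qfact q (int m)) * norm (inv_qfact q (int n)))"
      by (simp add: inv_qfact_of_nat norm_mult norm_divide)
    also have "\<dots> \<le> \<rho> ^ (n + m) * (C * C)"
      using \<rho> C w by (intro mult_mono) auto
    finally show ?thesis by (simp add: power_add mult_ac)
  qed
  have "(\<lambda>x. norm (case x of (n, m) \<Rightarrow> w n m / (qpoch q q m * qpoch q q n))) summable_on UNIV"
    by (rule Infinite_Sum.abs_summable_on_comparison_test'[OF dominating])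
       (use bound in \<open>simp add: case_prod_beta\<close>)
  then show ?thesis by (rule abs_summable_summable)
qed

lemma has_sum_qconv_antidiagonals:
  assumes "norm q < 1" "0 \<le> \<rho>" "\<rho> < 1" "\<And>n m. norm (w n m) \<le> \<rho> ^ (n + m)"
    and weight: "\<And>n m. w n m = a (n + m) (int m)"
  shows "((\<lambda>(n, m). w n m / (qpoch q q m * qpoch q q n)) has_sum S) UNIV
    \<longleftrightarrow> ((\<lambda>N. qconv q (a N) (int N) 0) has_sum S) UNIV"
proof -
  have "(\<Sum>m\<le>N. case (N - m, m) of (n, m) \<Rightarrow> w n m / (qpoch q q m * qpoch q q n))
      = qconv q (a N) (int N) 0" for N
    unfolding qconv_of_nat_0 by (rule sum.cong) (simp_all add: weight)
  then show ?thesis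
    unfolding has_sum_antidiagonals[OF double_series_summable[OF assms(1-4)]] by (simp only:)
qed

context nome
begin

lemma has_sum_rogers_antidiagonals:
  assumes x: "x \<noteq> 0" "norm x \<le> 1" and y: "y \<noteq> 0" "norm y \<le> 1"
  shows "((\<lambda>(k, j). q ^ ((k + j) * (k + j)) * (x ^ k * y ^ j)
      / (qpoch (q\<^sup>2) (q\<^sup>2) j * qpoch (q\<^sup>2) (q\<^sup>2) k)) has_sum S) UNIV
    \<longleftrightarrow> ((\<lambda>N. q ^ (N * N) * rogers_szego (q\<^sup>2) x y (int N)) has_sum S) UNIV"
proof -
  interpret sq: nome "q\<^sup>2" by (rule nome_power) simp
  let ?w = "\<lambda>k j. q ^ ((k + j) * (k + j)) * (x ^ k * y ^ j)"
  let ?a = "\<lambda>N j. q ^ (N * N) * (x powi (int N - j) * y powi j)"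
  have "norm (?w k j) \<le> norm q ^ (k + j)" for k j
  proof -
    have "norm (?w k j) \<le> norm q ^ ((k + j) * (k + j)) * (1 * 1)"
      unfolding norm_mult norm_power using x y by (intro mult_mono power_le_one) auto
    also have "\<dots> \<le> norm q ^ (k + j)"
      using norm_q_less_1 by (simp add: power_decreasing)
    finally show ?thesis .
  qed
  moreover have "?w k j = ?a (k + j) (int j)" for k j
    by simp
  ultimately have "((\<lambda>(k, j). ?w k j / (qpoch (q\<^sup>2) (q\<^sup>2) j * qpoch (q\<^sup>2) (q\<^sup>2) k)) has_sum S) UNIV
      \<longleftrightarrow> ((\<lambda>N. qconv (q\<^sup>2) (?a N) (int N) 0) has_sum S) UNIV"
    by (rule has_sum_qconv_antidiagonals[where w = ?w and a = ?a,
          OF sq.norm_q_less_1 norm_ge_zero norm_q_less_1])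
  then show ?thesis
    unfolding qconv_cmult rogers_szego_def .
qed

lemma has_sum_rogers_row:
  assumes y: "y \<noteq> 0" "norm y \<le> 1"
  shows "((\<lambda>j. q ^ ((k + j) * (k + j)) * (x ^ k * y ^ j)
      / (qpoch (q\<^sup>2) (q\<^sup>2) j * qpoch (q\<^sup>2) (q\<^sup>2) k)) has_sum
    qpoch_inf (- (y * q)) (q\<^sup>2)
      * (q ^ (k * k) * x ^ k / (qpoch (q\<^sup>2) (q\<^sup>2) k * qpoch (- (y * q)) (q\<^sup>2) k))) UNIV"
proof -
  interpret sq: nome "q\<^sup>2" by (rule nome_power) simp
  let ?t = "q ^ (k * k) * x ^ k / qpoch (q\<^sup>2) (q\<^sup>2) k" and ?z = "- (y * (q\<^sup>2) ^ k * q)"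
  have "(k + j) * (k + j) = k * k + 2 * k * j + j * j" for j
    by (simp add: algebra_simps)
  then have "q ^ ((k + j) * (k + j)) = q ^ (k * k) * ((q\<^sup>2) ^ k) ^ j * q ^ (j * j)" for j
    by (simp only: power_add power_mult)
  then have "q ^ ((k + j) * (k + j)) * (x ^ k * y ^ j) / (qpoch (q\<^sup>2) (q\<^sup>2) j * qpoch (q\<^sup>2) (q\<^sup>2) k)
      = ?t * (theta_term (q\<^sup>2) ?z (int j) / qpoch (q\<^sup>2) (q\<^sup>2) j)" for j
    unfolding theta_term_square by (simp add: power_mult_distrib mult_ac flip: of_nat_mult)
  moreover have "((\<lambda>j. theta_term (q\<^sup>2) ?z (int j) / qpoch (q\<^sup>2) (q\<^sup>2) j)
      has_sum qpoch_inf ?z (q\<^sup>2)) UNIV"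
    using y(1) q_nonzero by (intro sq.Euler_qpoch_inf) simp
  ultimately have "((\<lambda>j. q ^ ((k + j) * (k + j)) * (x ^ k * y ^ j)
      / (qpoch (q\<^sup>2) (q\<^sup>2) j * qpoch (q\<^sup>2) (q\<^sup>2) k)) has_sum ?t * qpoch_inf ?z (q\<^sup>2)) UNIV"
    by (simp only: has_sum_cmult_right)
  moreover have "qpoch_inf (- (y * q)) (q\<^sup>2) = qpoch (- (y * q)) (q\<^sup>2) k * qpoch_inf ?z (q\<^sup>2)"
    using qpoch_inf_split[OF sq.norm_q_less_1, of "- (y * q)" k] by (simp add: mult_ac)
  moreover have "qpoch (- (y * q)) (q\<^sup>2) k \<noteq> 0"
    using norm_mult_q_less_1[OF y(2)] by (intro qpoch_nonzero sq.norm_q_less_1) simp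
  ultimately show ?thesis by (simp add: mult_ac)
qed

theorem Rogers_transformation:
  assumes x: "x \<noteq> 0" "norm x \<le> 1" and y: "y \<noteq> 0" "norm y \<le> 1"
    and series: "((\<lambda>N. q ^ (N * N) * rogers_szego (q\<^sup>2) x y (int N)) has_sum S) UNIV"
  shows "((\<lambda>k. q ^ (k * k) * x ^ k / (qpoch (q\<^sup>2) (q\<^sup>2) k * qpoch (- (y * q)) (q\<^sup>2) k))
    has_sum S / qpoch_inf (- (y * q)) (q\<^sup>2)) UNIV"
proof -
  interpret sq: nome "q\<^sup>2" by (rule nome_power) simp
  have "((\<lambda>(k, j). q ^ ((k + j) * (k + j)) * (x ^ k * y ^ j)
      / (qpoch (q\<^sup>2) (q\<^sup>2) j * qpoch (q\<^sup>2) (q\<^sup>2) k)) has_sum S) (UNIV \<times> UNIV)"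
    using series has_sum_rogers_antidiagonals[OF x y] by simp
  then have "((\<lambda>k. qpoch_inf (- (y * q)) (q\<^sup>2)
      * (q ^ (k * k) * x ^ k / (qpoch (q\<^sup>2) (q\<^sup>2) k * qpoch (- (y * q)) (q\<^sup>2) k))) has_sum S) UNIV"
    by (rule has_sum_SigmaD) (use has_sum_rogers_row[OF y] in simp)
  moreover have "qpoch_inf (- (y * q)) (q\<^sup>2) \<noteq> 0"
    using norm_mult_q_less_1[OF y(2)] by (intro qpoch_inf_nonzero sq.norm_q_less_1) simp
  ultimately show ?thesis
    using has_sum_cmult_right_iff by blast
qed

lemma rogers_szego_base_square_power:
  assumes "e \<le> 1"
  shows "rogers_szego (q\<^sup>2) (q ^ (2 * e)) q (int N) = q ^ (e * N) * inv_qfact q (int N)"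
proof (cases "e = 0")
  case True
  then show ?thesis using rogers_szego_base_square[of 1 N] by simp
next
  case False
  then have "e = 1" using assms by simp
  then show ?thesis
    using rogers_szego_base_square[OF q_nonzero, of N] rogers_szego_commute[of "q\<^sup>2" "q\<^sup>2" q]
    by (simp add: power2_eq_square)
qed

corollary Rogers_Ramanujan_imp_base_fourth:
  assumes e: "e \<le> 1" and series: "((\<lambda>n. q ^ (n * n + e * n) / qpoch q q n) has_sum S) UNIV"
  shows "((\<lambda>k. q ^ (k * k + 2 * e * k) / qpoch (q ^ 4) (q ^ 4) k)
    has_sum S / qpoch_inf (- (q\<^sup>2)) (q\<^sup>2)) UNIV"
proof -
  have "((\<lambda>N. q ^ (N * N) * rogers_szego (q\<^sup>2) (q ^ (2 * e)) q (int N)) has_sum S) UNIV"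
    using series by (simp add: rogers_szego_base_square_power[OF e] inv_qfact_of_nat power_add)
  moreover have "norm (q ^ (2 * e)) \<le> 1"
    unfolding norm_power using norm_q_less_1 by (intro power_le_one) auto
  ultimately have "((\<lambda>k. q ^ (k * k) * (q ^ (2 * e)) ^ k
      / (qpoch (q\<^sup>2) (q\<^sup>2) k * qpoch (- (q * q)) (q\<^sup>2) k))
      has_sum S / qpoch_inf (- (q * q)) (q\<^sup>2)) UNIV"
    using q_nonzero norm_q_less_1 by (intro Rogers_transformation) simp_all
  moreover have "qpoch (q\<^sup>2) (q\<^sup>2) k * qpoch (- (q * q)) (q\<^sup>2) k = qpoch (q ^ 4) (q ^ 4) k" for k
    using qpoch_mult_uminus[of "q\<^sup>2" "q\<^sup>2" k] by (simp flip: power_mult power2_eq_square)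
  ultimately show ?thesis
    by (simp add: power_add power_mult power2_eq_square)
qed

lemma fourth_root_norm_less_1:
  assumes "r ^ 4 = q"
  shows "norm r < 1"
proof -
  have "norm r ^ 4 < 1" using norm_q_less_1 assms by (metis norm_power)
  then show ?thesis by (simp add: power_less_one_iff)
qed

lemma signed_exponent_antidiagonal:
  assumes r: "r ^ 4 = q"
  shows "r ^ (3 * m\<^sup>2 + 2 * m * n + 3 * n\<^sup>2 + e * (4 * m + 4 * n))
    = r ^ (2 * (n + m)\<^sup>2 + 4 * e * (n + m)) * r powi (int (n + m) - 2 * int m)\<^sup>2"
proof -
  have "int (3 * m\<^sup>2 + 2 * m * n + 3 * n\<^sup>2 + e * (4 * m + 4 * n))
      = int (2 * (n + m)\<^sup>2 + 4 * e * (n + m)) + (int (n + m) - 2 * int m)\<^sup>2"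
    by (simp add: power2_eq_square algebra_simps)
  moreover have "r \<noteq> 0" using r q_nonzero by auto
  ultimately show ?thesis
    unfolding power_int_of_nat[symmetric] by (simp only: power_int_add simp_thms)
qed

lemma has_sum_signed_double_series:
  assumes r: "r ^ 4 = q"
  shows "((\<lambda>(n, m). (- 1) powi int_choose_two (int n - int m)
      * r ^ (3 * m\<^sup>2 + 2 * m * n + 3 * n\<^sup>2 + e * (4 * m + 4 * n))
      / (qpoch q q m * qpoch q q n)) has_sum S) UNIV
    \<longleftrightarrow> ((\<lambda>k. (q\<^sup>2) ^ (k * k + e * k) / qpoch (q\<^sup>2) (q\<^sup>2) k) has_sum S) UNIV"
proof -
  let ?E = "\<lambda>m n. 3 * m\<^sup>2 + 2 * m * n + 3 * n\<^sup>2 + e * (4 * m + 4 * n)"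
  let ?w = "\<lambda>n m. (- 1) powi int_choose_two (int n - int m) * r ^ ?E m n"
  let ?a = "\<lambda>N j. r ^ (2 * N\<^sup>2 + 4 * e * N)
    * ((- 1) powi int_choose_two (int N - 2 * j) * r powi (int N - 2 * j)\<^sup>2)"
  have norm_r: "norm r < 1" by (rule fourth_root_norm_less_1[OF r])
  have "norm (?w n m) \<le> norm r ^ (n + m)" for n m
  proof -
    have "k \<le> 3 * k\<^sup>2" for k :: nat by (cases k) (auto simp: power2_eq_square)
    from this[of n] this[of m] have "n + m \<le> ?E m n" by linarith
    then show ?thesis
      using norm_r by (simp add: norm_mult norm_power norm_power_int power_decreasing)
  qed
  moreover have "?w n m = ?a (n + m) (int m)" for n m
    unfolding signed_exponent_antidiagonal[OF r] by simp
  ultimately have "((\<lambda>(n, m). ?w n m / (qpoch q q m * qpoch q q n)) has_sum S) UNIV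
      \<longleftrightarrow> ((\<lambda>N. qconv q (?a N) (int N) 0) has_sum S) UNIV"
    by (rule has_sum_qconv_antidiagonals[where w = ?w and a = ?a,
          OF norm_q_less_1 norm_ge_zero norm_r])
  also have "\<dots> \<longleftrightarrow> ((\<lambda>k. qconv q (?a (2 * k)) (int (2 * k)) 0) has_sum S) UNIV"
    unfolding qconv_cmult qconv_signed[OF r] by (rule has_sum_even_nat) simp
  finally have reduced: "((\<lambda>(n, m). ?w n m / (qpoch q q m * qpoch q q n)) has_sum S) UNIV
      \<longleftrightarrow> ((\<lambda>k. qconv q (?a (2 * k)) (int (2 * k)) 0) has_sum S) UNIV" .
  have "r ^ (2 * (2 * k)\<^sup>2 + 4 * e * (2 * k)) = (q\<^sup>2) ^ (k * k + e * k)" for k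
    unfolding r[symmetric] power_mult[symmetric] by (simp add: power2_eq_square algebra_simps)
  then have "qconv q (?a (2 * k)) (int (2 * k)) 0
      = (q\<^sup>2) ^ (k * k + e * k) / qpoch (q\<^sup>2) (q\<^sup>2) k" for k
    unfolding qconv_cmult qconv_signed[OF r] by (simp add: inv_qfact_of_nat)
  with reduced show ?thesis by (simp only:)
qed

lemma has_sum_alternating_double_series:
  assumes r: "r ^ 4 = q"
  shows "((\<lambda>(n, m). (- 1) ^ m * r ^ (m\<^sup>2 + 2 * m * n + n\<^sup>2 + e * (4 * m + 4 * n))
      / (qpoch (q\<^sup>2) (q\<^sup>2) m * qpoch (q\<^sup>2) (q\<^sup>2) n)) has_sum S) UNIV
    \<longleftrightarrow> ((\<lambda>k. q ^ (k * k + 2 * e * k) / qpoch (q ^ 4) (q ^ 4) k) has_sum S) UNIV"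
proof -
  interpret sq: nome "q\<^sup>2" by (rule nome_power) simp
  let ?w = "\<lambda>n m. (- 1) ^ m * r ^ (m\<^sup>2 + 2 * m * n + n\<^sup>2 + e * (4 * m + 4 * n))"
  let ?a = "\<lambda>N j. r ^ (N\<^sup>2 + 4 * e * N) * (1 powi (int N - j) * (- 1) powi j)"
  let ?h = "\<lambda>N. r ^ (N\<^sup>2 + 4 * e * N) * rogers_szego (q\<^sup>2) 1 (- 1) (int N)"
  have norm_r: "norm r < 1" by (rule fourth_root_norm_less_1[OF r])
  have exponent: "m\<^sup>2 + 2 * m * n + n\<^sup>2 + e * (4 * m + 4 * n) = (n + m)\<^sup>2 + 4 * e * (n + m)" for m n
    by (simp add: power2_eq_square algebra_simps)
  have "N \<le> N\<^sup>2 + 4 * e * N" for N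
    by (simp add: power2_eq_square trans_le_add1)
  then have "norm (?w n m) \<le> norm r ^ (n + m)" for n m
    unfolding exponent norm_mult norm_power using norm_r by (simp add: power_decreasing)
  moreover have "?w n m = ?a (n + m) (int m)" for n m
    unfolding exponent by simp
  ultimately have "((\<lambda>(n, m). ?w n m / (qpoch (q\<^sup>2) (q\<^sup>2) m * qpoch (q\<^sup>2) (q\<^sup>2) n)) has_sum S) UNIV
      \<longleftrightarrow> ((\<lambda>N. qconv (q\<^sup>2) (?a N) (int N) 0) has_sum S) UNIV"
    by (rule has_sum_qconv_antidiagonals[where w = ?w and a = ?a,
          OF sq.norm_q_less_1 norm_ge_zero norm_r])
  also have "\<dots> \<longleftrightarrow> (?h has_sum S) UNIV"
    unfolding qconv_cmult rogers_szego_def ..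
  also have "\<dots> \<longleftrightarrow> ((\<lambda>k. ?h (2 * k)) has_sum S) UNIV"
    by (rule has_sum_even_nat) (simp add: sq.rogers_szego_alternating)
  finally have reduced:
    "((\<lambda>(n, m). ?w n m / (qpoch (q\<^sup>2) (q\<^sup>2) m * qpoch (q\<^sup>2) (q\<^sup>2) n)) has_sum S) UNIV
      \<longleftrightarrow> ((\<lambda>k. ?h (2 * k)) has_sum S) UNIV" .
  have "r ^ ((2 * k)\<^sup>2 + 4 * e * (2 * k)) = q ^ (k * k + 2 * e * k)" for k
    unfolding r[symmetric] power_mult[symmetric] by (simp add: power2_eq_square algebra_simps)
  then have "?h (2 * k) = q ^ (k * k + 2 * e * k) / qpoch (q ^ 4) (q ^ 4) k" for k
    unfolding sq.rogers_szego_alternating by (simp add: inv_qfact_of_nat)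
  with reduced show ?thesis by (simp only:)
qed

end

theorem theorem1p1:
  fixes q r :: complex
  assumes q: "norm q < 1"
    and r: "r ^ 4 = q"
  shows "((\<lambda>(n, m). (-1) powi int_choose_two (int n - int m)
              * r ^ (3 * m\<^sup>2 + 2 * m * n + 3 * n\<^sup>2)
              / (qpoch q q m * qpoch q q n))
          has_sum (1 / qpochs_inf [q ^ 2, q ^ 8] (q ^ 10))) (UNIV :: (nat \<times> nat) set)
    \<and> ((\<lambda>(n, m). (-1) powi int_choose_two (int n - int m)
              * r ^ (3 * m\<^sup>2 + 2 * m * n + 3 * n\<^sup>2 + 4 * m + 4 * n)
              / (qpoch q q m * qpoch q q n))
          has_sum (1 / qpochs_inf [q ^ 4, q ^ 6] (q ^ 10))) (UNIV :: (nat \<times> nat) set)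
    \<and> ((\<lambda>(n, m). (-1) ^ m * r ^ (m\<^sup>2 + 2 * m * n + n\<^sup>2)
              / (qpoch (q ^ 2) (q ^ 2) m * qpoch (q ^ 2) (q ^ 2) n))
          has_sum (1 / (qpoch_inf (- (q ^ 2)) (q ^ 2) * qpochs_inf [q, q ^ 4] (q ^ 5))))
          (UNIV :: (nat \<times> nat) set)
    \<and> ((\<lambda>(n, m). (-1) ^ m * r ^ (m\<^sup>2 + 2 * m * n + n\<^sup>2 + 4 * m + 4 * n)
              / (qpoch (q ^ 2) (q ^ 2) m * qpoch (q ^ 2) (q ^ 2) n))
          has_sum (1 / (qpoch_inf (- (q ^ 2)) (q ^ 2) * qpochs_inf [q ^ 2, q ^ 3] (q ^ 5))))
          (UNIV :: (nat \<times> nat) set)"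
proof (cases "q = 0")
  case True
  then have "r = 0" using r by simp
  with True show ?thesis
    by (intro conjI; intro has_sum_finite_neutralI[of "{(0, 0)}"])
       (auto simp: qpochs_inf_def int_choose_two_def)
next
  case False
  interpret nome q using False q by unfold_locales
  interpret sq: nome "q\<^sup>2" by (rule nome_power) simp
  have base_square:
    "((\<lambda>k. (q\<^sup>2) ^ (k * k + 0 * k) / qpoch (q\<^sup>2) (q\<^sup>2) k) has_sum
      1 / qpochs_inf [q ^ 2, q ^ 8] (q ^ 10)) UNIV"
    "((\<lambda>k. (q\<^sup>2) ^ (k * k + 1 * k) / qpoch (q\<^sup>2) (q\<^sup>2) k) has_sum
      1 / qpochs_inf [q ^ 4, q ^ 6] (q ^ 10)) UNIV"
    using sq.Rogers_Ramanujan_1 sq.Rogers_Ramanujan_2 by (simp_all flip: power_mult)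
  have base_fourth:
    "((\<lambda>k. q ^ (k * k + 2 * 0 * k) / qpoch (q ^ 4) (q ^ 4) k) has_sum
      1 / qpochs_inf [q, q ^ 4] (q ^ 5) / qpoch_inf (- (q ^ 2)) (q ^ 2)) UNIV"
    "((\<lambda>k. q ^ (k * k + 2 * 1 * k) / qpoch (q ^ 4) (q ^ 4) k) has_sum
      1 / qpochs_inf [q ^ 2, q ^ 3] (q ^ 5) / qpoch_inf (- (q ^ 2)) (q ^ 2)) UNIV"
    using Rogers_Ramanujan_1 Rogers_Ramanujan_2 by (intro Rogers_Ramanujan_imp_base_fourth; simp)+
  show ?thesis
    using base_square[folded has_sum_signed_double_series[OF r]]
      base_fourth[folded has_sum_alternating_double_series[OF r]]
    by (simp add: mult.commute add.assoc)
qed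

end
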